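(* Suppose that a Stone space $X$ is equipped with an equicontinuous monoid action of a finitely generated monoid $M$. Then the dynamical system $(X,M)$ has the pseudo-orbit tracing property.
   Context: A Stone space is a compact, Hausdorff, totally disconnected topological space. A compact Hausdorff space $X$ carries a unique uniform structure inducing its topology; its entourages are the neighborhoods of the diagonal in $X\times X$. A monoid action of $M$ on $X$ is a map $M\times X\to X$, $(m,x)\mapsto mx$, with $m(m'x)=(mm')x$ and $1_Mx=x$. The action is equicontinuous if for every entourage $U$ of $X$ there is an entourage $V$ of $X$ such that for all $x,y\in X$, $(x,y)\in V$ implies $(mx,my)\in U$ for all $m\in M$. Pseudo-orbit tracing property: for a finite $K\subset M$ and an entourage $V$, a family $(x_m)_{m\in M}$ of points of $X$ is a $(K,V)$-pseudo-orbit if $(kx_m,x_{km})\in V$ for all $k\in K$, $m\in M$. It is $U$-traced by the orbit of $x\in X$ if $(mx,x_m)\in U$ for all $m\in M$. The system has the pseudo-orbit tracing property if for every entourage $U$ of $X$ there exist a finite subset $K\subset M$ and an entourage $V$ of $X$ such that every $(K,V)$-pseudo-orbit is $U$-traced by the orbit of some point of $X$. *)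

theory Defs
  imports "HOL-Analysis.Analysis" "HOL-Algebra.Group"
begin

definition totally_disconnected_space :: "'a topology \<Rightarrow> bool" where
  "totally_disconnected_space X \<longleftrightarrow> (\<forall>S. connectedin X S \<longrightarrow> (\<exists>a. S \<subseteq> {a}))"

definition Stone_space :: "'a topology \<Rightarrow> bool" where
  "Stone_space X \<longleftrightarrow> compact_space X \<and> Hausdorff_space X \<and> totally_disconnected_space X"

text \<open>
  On a compact Hausdorff space the unique compatible uniform structure consists of all
  neighborhoods of the diagonal. For other spaces \<open>entourage\<close> need not describe a uniformity.
\<close>

definition entourage :: "'a topology \<Rightarrow> ('a \<times> 'a) set \<Rightarrow> bool" where
  "entourage X U \<longleftrightarrow> U \<subseteq> topspace X \<times> topspace X \<and>
     (\<exists>W. openin (prod_topology X X) W \<and> Id_on (topspace X) \<subseteq> W \<and> W \<subseteq> U)"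

definition finitely_generated_monoid :: "('m, 'b) monoid_scheme \<Rightarrow> bool" where
  "finitely_generated_monoid M \<longleftrightarrow> monoid M \<and>
     (\<exists>S. finite S \<and> S \<subseteq> carrier M \<and> \<Inter>{H. submonoid H M \<and> S \<subseteq> H} = carrier M)"

text \<open>
  No continuity is built in; continuity of each \<open>\<phi> m\<close> follows from equicontinuity.
\<close>

definition monoid_action :: "('m, 'b) monoid_scheme \<Rightarrow> 'a set \<Rightarrow> ('m \<Rightarrow> 'a \<Rightarrow> 'a) \<Rightarrow> bool" where
  "monoid_action M A \<phi> \<longleftrightarrow>
     (\<forall>m\<in>carrier M. \<forall>x\<in>A. \<phi> m x \<in> A) \<and>
     (\<forall>m\<in>carrier M. \<forall>m'\<in>carrier M. \<forall>x\<in>A. \<phi> m (\<phi> m' x) = \<phi> (m \<otimes>\<^bsub>M\<^esub> m') x) \<and>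
     (\<forall>x\<in>A. \<phi> \<one>\<^bsub>M\<^esub> x = x)"

definition equicontinuous_action ::
    "('m, 'b) monoid_scheme \<Rightarrow> 'a topology \<Rightarrow> ('m \<Rightarrow> 'a \<Rightarrow> 'a) \<Rightarrow> bool" where
  "equicontinuous_action M X \<phi> \<longleftrightarrow>
     (\<forall>U. entourage X U \<longrightarrow> (\<exists>V. entourage X V \<and>
        (\<forall>x\<in>topspace X. \<forall>y\<in>topspace X. (x, y) \<in> V \<longrightarrow>
           (\<forall>m\<in>carrier M. (\<phi> m x, \<phi> m y) \<in> U))))"

definition pseudo_orbit ::
    "('m, 'b) monoid_scheme \<Rightarrow> 'a topology \<Rightarrow> ('m \<Rightarrow> 'a \<Rightarrow> 'a) \<Rightarrow>
     'm set \<Rightarrow> ('a \<times> 'a) set \<Rightarrow> ('m \<Rightarrow> 'a) \<Rightarrow> bool" where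
  "pseudo_orbit M X \<phi> K V x \<longleftrightarrow>
     (\<forall>m\<in>carrier M. x m \<in> topspace X) \<and>
     (\<forall>k\<in>K. \<forall>m\<in>carrier M. (\<phi> k (x m), x (k \<otimes>\<^bsub>M\<^esub> m)) \<in> V)"

definition traced_by ::
    "('m, 'b) monoid_scheme \<Rightarrow> ('m \<Rightarrow> 'a \<Rightarrow> 'a) \<Rightarrow> ('a \<times> 'a) set \<Rightarrow> ('m \<Rightarrow> 'a) \<Rightarrow> 'a \<Rightarrow> bool" where
  "traced_by M \<phi> U x z \<longleftrightarrow> (\<forall>m\<in>carrier M. (\<phi> m z, x m) \<in> U)"

definition pseudo_orbit_tracing_property ::
    "('m, 'b) monoid_scheme \<Rightarrow> 'a topology \<Rightarrow> ('m \<Rightarrow> 'a \<Rightarrow> 'a) \<Rightarrow> bool" where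
  "pseudo_orbit_tracing_property M X \<phi> \<longleftrightarrow>
     (\<forall>U. entourage X U \<longrightarrow>
        (\<exists>K V. finite K \<and> K \<subseteq> carrier M \<and> entourage X V \<and>
           (\<forall>x. pseudo_orbit M X \<phi> K V x \<longrightarrow> (\<exists>z\<in>topspace X. traced_by M \<phi> U x z))))"

end

theory Submission
  imports Defs
begin

text \<open>
  The uniformity of a Stone space \<open>X\<close> has a base of equivalence relations: a finite family of
  clopen sets partitions \<open>X\<close>, and compactness makes such a partition as fine as desired
  (\<open>Stone_space_equiv_entourage\<close>). Given an equicontinuous action, the pairs whose whole orbits
  stay equivalent with respect to a given one form a smaller equivalence entourage \<open>E\<close>, which the action preserves
  (\<open>equicontinuous_action_invariant_equiv\<close>).

  For such an \<open>E\<close>, errors along a pseudo-orbit do not accumulate. Passing from \<open>1\<close> to \<open>m\<close> by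
  generators, each step moves the pseudo-orbit off the true orbit only within an \<open>E\<close>-class;
  invariance carries earlier errors along and transitivity absorbs the new one, no matter how
  long the word is. Hence, with a finite generating set as \<open>K\<close>, the orbit of \<open>x 1\<close> itself traces
  every \<open>(K,E)\<close>-pseudo-orbit \<open>x\<close> (\<open>invariant_equiv_pseudo_orbit_traced\<close>).
\<close>

text \<open>
  In a compact Hausdorff space quasi-components are connected, hence here they are points;
  so distinct points are told apart by clopen sets.
\<close>

lemma Stone_space_clopen_separation:
  assumes "Stone_space X" "x \<in> topspace X" "y \<in> topspace X" "x \<noteq> y"
  obtains C where "closedin X C" "openin X C" "x \<in> C" "y \<notin> C"
proof -
  have "quasi_component_of X x = connected_component_of X x"
    using assms(1) by (intro quasi_eq_connected_component_of) (auto simp: Stone_space_def)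
  moreover have "\<not> connected_component_of X x y"
    using assms(1,4)
    unfolding Stone_space_def totally_disconnected_space_def connected_component_of_def
    by (metis singletonD subsetD)
  ultimately have "\<not> quasi_component_of X x y"
    by simp
  then obtain T where "closedin X T" "openin X T" "(x \<in> T) \<noteq> (y \<in> T)"
    using assms(2,3) by (auto simp: quasi_component_of_def)
  moreover from this have "closedin X (topspace X - T)" "openin X (topspace X - T)"
    by auto
  ultimately show thesis
    using that[of T] that[of "topspace X - T"] assms(2,3) by (cases "x \<in> T") auto
qed

text \<open>
  The rectangles \<open>C \<times> (X - C)\<close>, for \<open>C\<close> clopen, cover the complement of the diagonal. Finitely
  many of them cover the compact complement of an open neighborhood \<open>W \<subseteq> U\<close> of the diagonal,
  and two points on the same side of each of these finitely many \<open>C\<close> must then form a pair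
  in \<open>W\<close>.
\<close>

lemma Stone_space_equiv_entourage:
  assumes "Stone_space X" and "entourage X U"
  obtains E where "equiv (topspace X) E" "entourage X E" "E \<subseteq> U"
proof -
  define A where "A = topspace X"
  obtain W where W: "openin (prod_topology X X) W" "Id_on A \<subseteq> W" "W \<subseteq> U"
    using assms(2) by (auto simp: entourage_def A_def)
  define R where "R = (\<lambda>C. C \<times> (A - C))"
  define clopens where "clopens = {C. closedin X C \<and> openin X C}"
  have "compact_space (prod_topology X X)"
    using assms(1) by (simp add: Stone_space_def compact_space_prod_topology)
  moreover have "closedin (prod_topology X X) (A \<times> A - W)"
    using W(1) closedin_topspace[of "prod_topology X X"] by (auto simp: A_def)
  ultimately have "compactin (prod_topology X X) (A \<times> A - W)"
    by (rule closedin_compact_space)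
  moreover have "openin (prod_topology X X) V" if "V \<in> R ` clopens" for V
    using that by (auto simp: R_def clopens_def A_def openin_prod_Times_iff openin_diff)
  moreover have "A \<times> A - W \<subseteq> \<Union> (R ` clopens)"
  proof
    fix p assume p: "p \<in> A \<times> A - W"
    obtain x y where xy: "p = (x, y)" "x \<in> A" "y \<in> A" "(x, y) \<notin> W"
      using p by auto
    then have "x \<noteq> y"
      using W(2) by auto
    then obtain C where "C \<in> clopens" "x \<in> C" "y \<notin> C"
      using Stone_space_clopen_separation[OF assms(1)] xy
      by (metis A_def clopens_def mem_Collect_eq)
    then show "p \<in> \<Union> (R ` clopens)"
      using xy by (auto simp: R_def)
  qed
  ultimately obtain \<F> where "finite \<F>" "\<F> \<subseteq> R ` clopens" "A \<times> A - W \<subseteq> \<Union> \<F>"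
    using compactinD[of _ _ "R ` clopens"] by meson
  then obtain F where F: "finite F" "F \<subseteq> clopens" "A \<times> A - W \<subseteq> \<Union> (R ` F)"
    by (metis finite_subset_image)
  define E where "E = {(x, y) \<in> A \<times> A. \<forall>C\<in>F. x \<in> C \<longleftrightarrow> y \<in> C}"
  have "equiv A E"
    by (auto simp: E_def equiv_def refl_on_def sym_def trans_def)
  moreover have "E \<subseteq> W"
  proof clarify
    fix x y assume xy: "(x, y) \<in> E"
    then have "(x, y) \<notin> \<Union> (R ` F)"
      by (auto simp: E_def R_def)
    then show "(x, y) \<in> W"
      using F(3) xy by (auto simp: E_def)
  qed
  moreover have "openin (prod_topology X X) E"
  proof -
    have "openin (prod_topology X X) (C \<times> C \<union> (A - C) \<times> (A - C))" if "C \<in> F" for C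
      using that F(2) by (intro openin_Un) (auto simp: clopens_def A_def openin_prod_Times_iff)
    then have "openin (prod_topology X X)
        ((\<Inter>C\<in>F. C \<times> C \<union> (A - C) \<times> (A - C)) \<inter> topspace (prod_topology X X))"
      using F(1) by (intro openin_INT) auto
    moreover have "E = (\<Inter>C\<in>F. C \<times> C \<union> (A - C) \<times> (A - C)) \<inter> A \<times> A"
      by (auto simp: E_def)
    ultimately show ?thesis
      by (simp add: A_def)
  qed
  moreover have "Id_on A \<subseteq> E" "E \<subseteq> A \<times> A"
    by (auto simp: E_def)
  ultimately show thesis
    using that[of E] W(3) unfolding entourage_def A_def by blast
qed

text \<open>
  The relation used is the largest invariant one inside \<open>E\<close>: pairs whose translates all lie
  in \<open>E\<close>. Equicontinuity is precisely the statement that it is still an entourage.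
\<close>

lemma equicontinuous_action_invariant_equiv:
  assumes M: "monoid M" and act: "monoid_action M (topspace X) \<phi>"
    and equi: "equicontinuous_action M X \<phi>"
    and E: "equiv (topspace X) E" "entourage X E"
  obtains D where "equiv (topspace X) D" "entourage X D" "D \<subseteq> E"
    "\<And>m x y. m \<in> carrier M \<Longrightarrow> (x, y) \<in> D \<Longrightarrow> (\<phi> m x, \<phi> m y) \<in> D"
proof -
  interpret monoid M by (rule M)
  define A where "A = topspace X"
  have closed: "\<phi> m x \<in> A" if "m \<in> carrier M" "x \<in> A" for m x
    using act that by (simp add: monoid_action_def A_def)
  have assoc: "\<phi> m (\<phi> n x) = \<phi> (m \<otimes>\<^bsub>M\<^esub> n) x"
    if "m \<in> carrier M" "n \<in> carrier M" "x \<in> A" for m n x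
    using act that by (simp add: monoid_action_def A_def)
  have unit: "\<phi> \<one>\<^bsub>M\<^esub> x = x" if "x \<in> A" for x
    using act that by (simp add: monoid_action_def A_def)
  define D where "D = {(x, y) \<in> A \<times> A. \<forall>m\<in>carrier M. (\<phi> m x, \<phi> m y) \<in> E}"
  have "equiv A D"
    using E(1) closed unfolding A_def[symmetric]
    by (auto simp: D_def equiv_def refl_on_def intro!: symI transI dest: symD transD)
  moreover have "entourage X D"
  proof -
    obtain V where V: "entourage X V"
      "\<forall>x\<in>A. \<forall>y\<in>A. (x, y) \<in> V \<longrightarrow> (\<forall>m\<in>carrier M. (\<phi> m x, \<phi> m y) \<in> E)"
      using equi E(2) unfolding equicontinuous_action_def A_def by blast
    then have "V \<subseteq> D"
      by (auto simp: D_def entourage_def A_def)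
    moreover have "D \<subseteq> A \<times> A"
      by (auto simp: D_def)
    ultimately show ?thesis
      using V(1) unfolding entourage_def A_def by blast
  qed
  moreover have "D \<subseteq> E"
    using unit by (auto simp: D_def) (metis one_closed)
  moreover have "(\<phi> m x, \<phi> m y) \<in> D" if "m \<in> carrier M" "(x, y) \<in> D" for m x y
    using that by (auto simp: D_def closed assoc)
  ultimately show thesis
    using that unfolding A_def by blast
qed

text \<open>
  The elements \<open>h\<close> that satisfy the pseudo-orbit condition at every \<open>m\<close> form a submonoid, because
  \<open>D\<close> is transitive and invariant. It contains the generators, so it is everything, and the
  condition at \<open>m = 1\<close> is the tracing by \<open>x 1\<close>.
\<close>

lemma invariant_equiv_pseudo_orbit_traced:
  assumes M: "monoid M" and act: "monoid_action M (topspace X) \<phi>"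
    and S: "S \<subseteq> carrier M" "\<Inter>{H. submonoid H M \<and> S \<subseteq> H} = carrier M"
    and D: "equiv (topspace X) D"
    and inv: "\<And>m x y. m \<in> carrier M \<Longrightarrow> (x, y) \<in> D \<Longrightarrow> (\<phi> m x, \<phi> m y) \<in> D"
    and x: "pseudo_orbit M X \<phi> S D x"
  shows "traced_by M \<phi> D x (x \<one>\<^bsub>M\<^esub>)"
proof -
  interpret monoid M by (rule M)
  have xA: "x m \<in> topspace X" if "m \<in> carrier M" for m
    using x that by (simp add: pseudo_orbit_def)
  define H where
    "H = {h \<in> carrier M. \<forall>m\<in>carrier M. (\<phi> h (x m), x (h \<otimes>\<^bsub>M\<^esub> m)) \<in> D}"
  have "submonoid H M"
  proof
    show "H \<subseteq> carrier M"
      by (auto simp: H_def)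
  next
    fix g h assume gh: "g \<in> H" "h \<in> H"
    then have c: "g \<in> carrier M" "h \<in> carrier M"
      by (auto simp: H_def)
    have "(\<phi> (g \<otimes>\<^bsub>M\<^esub> h) (x m), x (g \<otimes>\<^bsub>M\<^esub> h \<otimes>\<^bsub>M\<^esub> m)) \<in> D" if m: "m \<in> carrier M" for m
    proof -
      have "(\<phi> g (\<phi> h (x m)), \<phi> g (x (h \<otimes>\<^bsub>M\<^esub> m))) \<in> D"
        using inv gh m c by (simp add: H_def)
      moreover have "(\<phi> g (x (h \<otimes>\<^bsub>M\<^esub> m)), x (g \<otimes>\<^bsub>M\<^esub> (h \<otimes>\<^bsub>M\<^esub> m))) \<in> D"
        using gh m c by (simp add: H_def)
      ultimately have "(\<phi> g (\<phi> h (x m)), x (g \<otimes>\<^bsub>M\<^esub> (h \<otimes>\<^bsub>M\<^esub> m))) \<in> D"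
        using D by (meson equivE transD)
      moreover have "\<phi> g (\<phi> h (x m)) = \<phi> (g \<otimes>\<^bsub>M\<^esub> h) (x m)"
        using act c xA[OF m] by (simp add: monoid_action_def)
      ultimately show ?thesis
        using c m by (simp add: m_assoc)
    qed
    then show "g \<otimes>\<^bsub>M\<^esub> h \<in> H"
      using c by (simp add: H_def)
  next
    show "\<one>\<^bsub>M\<^esub> \<in> H"
      using act xA D by (auto simp: H_def monoid_action_def equiv_def refl_on_def)
  qed
  moreover have "S \<subseteq> H"
    using S(1) x by (auto simp: H_def pseudo_orbit_def)
  ultimately have "carrier M \<subseteq> H"
    using S(2) by blast
  then have "(\<phi> m (x \<one>\<^bsub>M\<^esub>), x (m \<otimes>\<^bsub>M\<^esub> \<one>\<^bsub>M\<^esub>)) \<in> D" if "m \<in> carrier M" for m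
    using that one_closed by (simp add: H_def subset_iff del: r_one)
  then show ?thesis
    by (simp add: traced_by_def)
qed

theorem theorem5p6:
  fixes X :: "'a topology" and M :: "('m, 'b) monoid_scheme" and \<phi> :: "'m \<Rightarrow> 'a \<Rightarrow> 'a"
  assumes "Stone_space X"
    and "finitely_generated_monoid M"
    and "monoid_action M (topspace X) \<phi>"
    and "equicontinuous_action M X \<phi>"
  shows "pseudo_orbit_tracing_property M X \<phi>"
  unfolding pseudo_orbit_tracing_property_def
proof (intro allI impI)
  fix U assume "entourage X U"
  obtain S where M: "monoid M"
    and S: "finite S" "S \<subseteq> carrier M" "\<Inter>{H. submonoid H M \<and> S \<subseteq> H} = carrier M"
    using assms(2) by (auto simp: finitely_generated_monoid_def)
  obtain E where E: "equiv (topspace X) E" "entourage X E" "E \<subseteq> U"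
    using Stone_space_equiv_entourage[OF assms(1) \<open>entourage X U\<close>] .
  obtain D where D: "equiv (topspace X) D" "entourage X D" "D \<subseteq> E"
    "\<And>m x y. m \<in> carrier M \<Longrightarrow> (x, y) \<in> D \<Longrightarrow> (\<phi> m x, \<phi> m y) \<in> D"
    using equicontinuous_action_invariant_equiv[OF M assms(3,4) E(1,2)] by metis
  have "\<exists>z\<in>topspace X. traced_by M \<phi> U x z" if x: "pseudo_orbit M X \<phi> S D x" for x
  proof
    have "traced_by M \<phi> D x (x \<one>\<^bsub>M\<^esub>)"
      using invariant_equiv_pseudo_orbit_traced[OF M assms(3) S(2,3) D(1,4) x] .
    then show "traced_by M \<phi> U x (x \<one>\<^bsub>M\<^esub>)"
      using D(3) E(3) by (auto simp: traced_by_def)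
    show "x \<one>\<^bsub>M\<^esub> \<in> topspace X"
      using x M by (simp add: pseudo_orbit_def)
  qed
  then show "\<exists>K V. finite K \<and> K \<subseteq> carrier M \<and> entourage X V \<and>
      (\<forall>x. pseudo_orbit M X \<phi> K V x \<longrightarrow> (\<exists>z\<in>topspace X. traced_by M \<phi> U x z))"
    using S(1,2) D(2) by blast
qed

end
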